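(* Let $(F,<)$ be a totally ordered and Archimedean field and $r\in F$ with $-1<r<1$. Then $\lim_{n\to+\infty}r^n=0$.
   Context: A totally ordered field $F$ is Archimedean if for any positive element $x$ and any element $y$ of $F$ there is a natural number $n$ such that $nx>y$. With $|x|=\max\{x,-x\}$, $\lim_{n\to+\infty}x_n=a$ in $F$ means that for every $\epsilon>0$ in $F$ there is a natural number $N$ such that $n\geq N$ implies $|x_n-a|<\epsilon$. *)

theory Defs imports Complex_Main begin

text \<open>
  The library class \<open>archimedean_field\<close> is a linearly ordered field satisfying
  \<open>ex_le_of_int\<close>: every element lies below some integer. For linearly ordered fields
  this is the usual Archimedean property:
\<close>

lemma archimedean_property_iff_ex_le_of_int:
  "(\<forall>x::'a::linordered_field. \<forall>y. x > 0 \<longrightarrow> (\<exists>n::nat. of_nat n * x > y))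
    \<longleftrightarrow> (\<forall>x::'a. \<exists>z::int. x \<le> of_int z)"
proof
  assume L: "\<forall>x::'a. \<forall>y. x > 0 \<longrightarrow> (\<exists>n::nat. of_nat n * x > y)"
  show "\<forall>x::'a. \<exists>z::int. x \<le> of_int z"
  proof
    fix x :: 'a
    obtain n :: nat where "of_nat n * 1 > x" using L zero_less_one by blast
    then have "x \<le> of_int (int n)" by simp
    then show "\<exists>z::int. x \<le> of_int z" by blast
  qed
next
  assume R: "\<forall>x::'a. \<exists>z::int. x \<le> of_int z"
  show "\<forall>x::'a. \<forall>y. x > 0 \<longrightarrow> (\<exists>n::nat. of_nat n * x > y)"
  proof (intro allI impI)
    fix x y :: 'a
    assume x: "x > 0"
    obtain z :: int where z: "y / x \<le> of_int z" using R by blast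
    have "(of_int z :: 'a) < of_int (int (nat (z + 1)))" by simp
    then have "(of_int z :: 'a) < of_nat (nat (z + 1))" by (simp only: of_int_of_nat_eq)
    with z have "y / x < of_nat (nat (z + 1))" by simp
    then show "\<exists>n::nat. of_nat n * x > y" using x by (auto simp: pos_divide_less_eq)
  qed
qed

text \<open>
  Convergence with \<open>\<epsilon>\<close> ranging over the ordered field itself. The library's \<open>tendsto\<close>
  is not available here, since a linearly ordered field does not carry a topology.
\<close>

definition converges_to :: "(nat \<Rightarrow> 'a::linordered_field) \<Rightarrow> 'a \<Rightarrow> bool" where
  "converges_to x a \<longleftrightarrow> (\<forall>\<epsilon>>0. \<exists>N. \<forall>n\<ge>N. \<bar>x n - a\<bar> < \<epsilon>)"

end

theory Submission imports Defs begin

text \<open>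
  Put \<open>h = 1 - \<bar>r\<bar> > 0\<close>. The quantity \<open>\<bar>r\<bar>\<^sup>n (n h + 1)\<close> equals 1 at \<open>n = 0\<close> and never
  increases with \<open>n\<close>, so it stays at most 1 (\<open>power_times_linear_le_one\<close>): the powers decay at
  least as fast as \<open>1 / (n h + 1)\<close>. By the Archimedean property \<open>N h > 1 / \<epsilon>\<close> for some \<open>N\<close>,
  so \<open>\<bar>r\<bar>\<^sup>N < \<epsilon>\<close>, and later powers of \<open>\<bar>r\<bar> \<le> 1\<close> are no larger.
\<close>

text \<open>
  For \<open>x > 0\<close> this is Bernoulli's inequality for \<open>1 / x\<close>, weakened by \<open>1 / x - 1 \<ge> 1 - x\<close>.
  Stated without division it covers \<open>x = 0\<close> as well.
\<close>

lemma power_times_linear_le_one: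
  fixes x :: "'a::linordered_field"
  assumes "0 \<le> x" and "x \<le> 1"
  shows "x ^ n * (of_nat n * (1 - x) + 1) \<le> 1"
proof (induction n)
  case 0
  show ?case by simp
next
  case (Suc n)
  have "x * (of_nat (Suc n) * (1 - x) + 1)
      = (of_nat n * (1 - x) + 1) - of_nat (Suc n) * ((1 - x) * (1 - x))"
    by (simp add: algebra_simps)
  also have "\<dots> \<le> of_nat n * (1 - x) + 1"
    by (simp del: of_nat_Suc)
  finally have "x ^ n * (x * (of_nat (Suc n) * (1 - x) + 1)) \<le> x ^ n * (of_nat n * (1 - x) + 1)"
    using assms by (intro mult_left_mono) simp_all
  with Suc.IH show ?case by (simp only: power_Suc2 mult.assoc)
qed

theorem proposition4p5:
  fixes r :: "'a::archimedean_field"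
  assumes "-1 < r" and "r < 1"
  shows "converges_to (\<lambda>n. r ^ n) 0"
  unfolding converges_to_def
proof (intro allI impI)
  fix \<epsilon> :: 'a
  assume eps: "\<epsilon> > 0"
  have r1: "\<bar>r\<bar> < 1" using assms by (simp add: abs_less_iff)
  obtain N where N: "1 / \<epsilon> < of_nat N * (1 - \<bar>r\<bar>)"
    using ex_less_of_nat_mult[of "1 - \<bar>r\<bar>" "1 / \<epsilon>"] r1 by auto
  have small: "\<bar>r\<bar> ^ N < \<epsilon>"
  proof (rule ccontr)
    assume "\<not> \<bar>r\<bar> ^ N < \<epsilon>"
    then have "\<epsilon> * (of_nat N * (1 - \<bar>r\<bar>) + 1) \<le> \<bar>r\<bar> ^ N * (of_nat N * (1 - \<bar>r\<bar>) + 1)"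
      using r1 by (intro mult_right_mono) simp_all
    also have "\<dots> \<le> 1" using r1 by (intro power_times_linear_le_one) simp_all
    finally have "\<epsilon> * (of_nat N * (1 - \<bar>r\<bar>)) + \<epsilon> \<le> 1" by (simp only: distrib_left mult_1_right)
    moreover have "1 < \<epsilon> * (of_nat N * (1 - \<bar>r\<bar>))"
      using N eps by (simp only: pos_divide_less_eq mult.commute)
    ultimately show False using eps by simp
  qed
  have "\<bar>r ^ n - 0\<bar> < \<epsilon>" if "n \<ge> N" for n
  proof -
    have "\<bar>r\<bar> ^ n \<le> \<bar>r\<bar> ^ N" using that r1 by (intro power_decreasing) simp_all
    with small show ?thesis by (simp add: power_abs)
  qed
  then show "\<exists>N. \<forall>n\<ge>N. \<bar>r ^ n - 0\<bar> < \<epsilon>" by blast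
qed

end
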